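(* Let $B$ be a nonempty set of sets, partially ordered by inclusion. If for every nonempty chain $C\subseteq B$ one has $\bigcup_{X\in C}X\in B$ and $\bigcap_{X\in C}X\in B$, then $B$ satisfies (K2), i.e. for all $X_1\subset X_2$ in $B$ there exist $Y_1,Y_2\in B$ with $X_1\subseteq Y_1\subset Y_2\subseteq X_2$ such that $Y_1$ and $Y_2$ are immediate neighbors in $B$.
   Context: $\subset$ denotes proper inclusion. In a poset $S$, $a,b$ are immediate neighbors if $a<b$ and there is no $c\in S$ with $a<c<b$. A chain is a totally ordered subset. *)

theory Defs
  imports Main
begin

definition immediate_neighbors :: "'a::order set \<Rightarrow> 'a \<Rightarrow> 'a \<Rightarrow> bool" where
  "immediate_neighbors S a b \<longleftrightarrow>
     a \<in> S \<and> b \<in> S \<and> a < b \<and> \<not> (\<exists>c\<in>S. a < c \<and> c < b)"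

definition K2 :: "'a set set \<Rightarrow> bool" where
  "K2 B \<longleftrightarrow>
     (\<forall>X1\<in>B. \<forall>X2\<in>B. X1 \<subset> X2 \<longrightarrow>
        (\<exists>Y1\<in>B. \<exists>Y2\<in>B. X1 \<subseteq> Y1 \<and> Y1 \<subset> Y2 \<and> Y2 \<subseteq> X2 \<and> immediate_neighbors B Y1 Y2))"

end

theory Submission
  imports Defs
begin

text \<open>Fix \<open>x \<in> X2 - X1\<close>. By Zorn's lemma there is a maximal \<open>Y1\<close> among the members of \<open>B\<close> between
  \<open>X1\<close> and \<open>X2\<close> that avoid \<open>x\<close>, and then a minimal \<open>Y2\<close> among those between \<open>Y1\<close> and \<open>X2\<close> that
  contain \<open>x\<close>. A member of \<open>B\<close> strictly between \<open>Y1\<close> and \<open>Y2\<close> would contradict maximality of \<open>Y1\<close>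
  or minimality of \<open>Y2\<close>, according to whether it contains \<open>x\<close>.\<close>

text \<open>Complementation reverses inclusion and turns intersections into unions, so a maximal
  complement, supplied by Zorn's lemma, comes from a minimal member of \<open>A\<close>.\<close>

lemma subset_Zorn_minimal:
  fixes A :: "'a set set"
  assumes "A \<noteq> {}"
    and "\<And>C. C \<noteq> {} \<Longrightarrow> subset.chain A C \<Longrightarrow> \<Inter>C \<in> A"
  shows "\<exists>M\<in>A. \<forall>X\<in>A. X \<subseteq> M \<longrightarrow> X = M"
proof -
  have "\<exists>M\<in>uminus ` A. \<forall>X\<in>uminus ` A. M \<subseteq> X \<longrightarrow> X = M"
  proof (rule subset_Zorn_nonempty)
    show "uminus ` A \<noteq> {}"
      using assms(1) by simp
    fix C assume "C \<noteq> {}" and C: "subset.chain (uminus ` A) C"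
    have "subset.chain A (uminus ` C)"
      using C by (auto simp: subset_chain_def)
    with \<open>C \<noteq> {}\<close> have "\<Inter>(uminus ` C) \<in> A"
      by (intro assms(2)) auto
    moreover have "\<Union>C = - \<Inter>(uminus ` C)"
      by auto
    ultimately show "\<Union>C \<in> uminus ` A"
      by (rule rev_image_eqI)
  qed
  then show ?thesis
    by auto
qed

theorem lemma2p2:
  fixes B :: "'a set set"
  assumes "B \<noteq> {}"
    and "\<And>C. subset.chain B C \<Longrightarrow> C \<noteq> {} \<Longrightarrow> (\<Union>X\<in>C. X) \<in> B \<and> (\<Inter>X\<in>C. X) \<in> B"
  shows "K2 B"
  unfolding K2_def
proof (intro ballI impI)
  fix X1 X2 assume X: "X1 \<in> B" "X2 \<in> B" "X1 \<subset> X2"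
  then obtain x where x: "x \<in> X2" "x \<notin> X1"
    by blast
  \<comment> \<open>A chain in a subfamily of \<open>B\<close> is a chain in \<open>B\<close>; this
    is applied with \<open>S\<close> being \<open>P\<close> and \<open>Q\<close>.\<close>
  have B_Union: "\<Union>C \<in> B" and B_Inter: "\<Inter>C \<in> B"
    if "C \<noteq> {}" "subset.chain S C" "S \<subseteq> B" for C S
    using assms(2)[of C] that by (auto simp: subset_chain_def)
  define P where "P = {Y \<in> B. X1 \<subseteq> Y \<and> Y \<subseteq> X2 \<and> x \<notin> Y}"
  have "\<exists>M\<in>P. \<forall>Y\<in>P. M \<subseteq> Y \<longrightarrow> Y = M"
  proof (rule subset_Zorn_nonempty)
    \<comment> \<open>The witness is \<open>X1\<close>.\<close>
    show "P \<noteq> {}"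
      using X x by (auto simp: P_def)
    fix C assume C: "C \<noteq> {}" "subset.chain P C"
    then have "\<Union>C \<in> B"
      by (rule B_Union) (auto simp: P_def)
    moreover have "C \<subseteq> P"
      using C by (simp add: subset_chain_def)
    \<comment> \<open>A member of \<open>C\<close> is needed for
      \<open>X1 \<subseteq> \<Union>C\<close>.\<close>
    ultimately show "\<Union>C \<in> P"
      using C(1) by (fastforce simp: P_def)
  qed
  then obtain Y1 where Y1: "Y1 \<in> B" "X1 \<subseteq> Y1" "Y1 \<subseteq> X2" "x \<notin> Y1"
    and max: "\<And>Y. Y \<in> P \<Longrightarrow> Y1 \<subseteq> Y \<Longrightarrow> Y = Y1"
    by (auto simp: P_def)
  define Q where "Q = {Y \<in> B. Y1 \<subseteq> Y \<and> Y \<subseteq> X2 \<and> x \<in> Y}"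
  have "\<exists>M\<in>Q. \<forall>Y\<in>Q. Y \<subseteq> M \<longrightarrow> Y = M"
  proof (rule subset_Zorn_minimal)
    \<comment> \<open>The witness is \<open>X2\<close>.\<close>
    show "Q \<noteq> {}"
      using X x Y1 by (auto simp: Q_def)
    fix C assume C: "C \<noteq> {}" "subset.chain Q C"
    then have "\<Inter>C \<in> B"
      by (rule B_Inter) (auto simp: Q_def)
    moreover have "C \<subseteq> Q"
      using C by (simp add: subset_chain_def)
    \<comment> \<open>Dually, a member of \<open>C\<close> is needed for
      \<open>\<Inter>C \<subseteq> X2\<close>.\<close>
    ultimately show "\<Inter>C \<in> Q"
      using C(1) by (fastforce simp: Q_def)
  qed
  then obtain Y2 where Y2: "Y2 \<in> B" "Y1 \<subseteq> Y2" "Y2 \<subseteq> X2" "x \<in> Y2"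
    and min: "\<And>Y. Y \<in> Q \<Longrightarrow> Y \<subseteq> Y2 \<Longrightarrow> Y = Y2"
    by (auto simp: Q_def)
  have no_between: False if "Z \<in> B" "Y1 \<subset> Z" "Z \<subset> Y2" for Z
  proof (cases "x \<in> Z")
    case True
    then have "Z \<in> Q"
      using that Y2 by (auto simp: Q_def)
    then show False
      using min that by blast
  next
    case False
    then have "Z \<in> P"
      using that Y1 Y2 by (auto simp: P_def)
    then show False
      using max that by blast
  qed
  \<comment> \<open>The inclusion is strict because \<open>x\<close> lies in \<open>Y2\<close> but
    not in \<open>Y1\<close>.\<close>
  have "Y1 \<subset> Y2"
    using Y1 Y2 by blast
  moreover from this have "immediate_neighbors B Y1 Y2"
    unfolding immediate_neighbors_def using Y1(1) Y2(1) no_between by blast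
  ultimately show "\<exists>Y1\<in>B. \<exists>Y2\<in>B. X1 \<subseteq> Y1 \<and> Y1 \<subset> Y2 \<and> Y2 \<subseteq> X2 \<and> immediate_neighbors B Y1 Y2"
    using Y1 Y2 by blast
qed

end
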